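(* For Lebesgue almost every length vector $(\ell_1,\ell_2,\ell_3)$ (with $\ell_i>0$, $\ell_1+\ell_2+\ell_3=1$), the $3$-interval exchange transformation $T$ with these lengths and permutation $\pi=(3\ 2\ 1)$ (i.e. $\pi(k)=4-k$) satisfies, for every $\alpha>0$, \[\liminf_{n\to\infty} n^\alpha\,|T^n(x)-T^n(y)|=\infty\quad\text{for } \lambda\times\lambda\text{-almost every }(x,y)\in[0,1)^2,\] where $\lambda$ is Lebesgue measure on $[0,1)$.
   Context: An $r$-interval exchange transformation is given by a permutation $\pi$ of $\{1,\dots,r\}$ and lengths $\ell_i>0$ with $\sum\ell_i=1$: with $s_0=0$, $s_k=\sum_{i\le k}\ell_i$, $I_k=[s_{k-1},s_k)$, one sets $T(x)=x-\sum_{i<k}\ell_i+\sum_{\pi(i')<\pi(k)}\ell_{i'}$ for $x\in I_k$. "Lebesgue almost every length vector" refers to Lebesgue measure on the $2$-dimensional simplex of such vectors. *)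

theory Defs
  imports "HOL-Analysis.Analysis"
begin

definition iet_s :: "(nat \<Rightarrow> real) \<Rightarrow> nat \<Rightarrow> real" where
  "iet_s l k = (\<Sum>i\<in>{1..k}. l i)"

text \<open>The r-interval exchange transformation with permutation pi and lengths l:
  for x in I_k = [s_(k-1), s_k), T x = x - sum_(i<k) l_i + sum_(pi i' < pi k) l_i'.
  Outside [0, s_r) we let T be the identity (irrelevant: [0,1) is invariant).
  The intervals I_k are pairwise disjoint when all l_i > 0, so the sum below
  picks out exactly one term.\<close>
definition iet :: "nat \<Rightarrow> (nat \<Rightarrow> nat) \<Rightarrow> (nat \<Rightarrow> real) \<Rightarrow> real \<Rightarrow> real" where
  "iet r \<pi> l x =
     (if iet_s l 0 \<le> x \<and> x < iet_s l r then
        (\<Sum>k\<in>{1..r}. if iet_s l (k - 1) \<le> x \<and> x < iet_s l k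
           then x - (\<Sum>i\<in>{1..<k}. l i) + (\<Sum>i'\<in>{i'\<in>{1..r}. \<pi> i' < \<pi> k}. l i')
           else 0)
      else x)"

definition len3 :: "real \<Rightarrow> real \<Rightarrow> nat \<Rightarrow> real" where
  "len3 a b i = (if i = 1 then a else if i = 2 then b else 1 - a - b)"

end

theory Submission imports Defs "HOL-Library.Nat_Bijection" begin

text \<open>With L = 1 + b and t = 1 - a, the map T is the first return map to [0, 1) of the rotation by t
  on a circle of length L, so T^n x = x + N t - M L, where n is the number of visits of the
  rotation to [0, 1) up to time N.  For almost every (a, b) the angle t / L is Diophantine with
  exponent arbitrarily close to 1, and the visit counts have discrepancy O(n^e) uniformly in the
  starting point.  Hence T^n x - T^n y = x - y + m t - m' L with m, m' = O(n^e), and by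
  Borel-Cantelli such a number is, for almost every (x, y), at least a negative power
  of (1 + |m|)(1 + |m'|).\<close>

section \<open>Almost every real keeps a quantitative distance from a doubly indexed family\<close>

text \<open>As \<open>s > 1\<close>, the weights \<open>w\<close> are summable, so intervals of
  radius \<open>w i * w j / (k + 1)\<close> about the points \<open>z i j\<close> have total length
  O(1 / (k + 1)). A point violating the claim lies in such a union \<open>B k\<close> for every
  \<open>k\<close>, hence in a null set.\<close>

lemma AE_far_from_double_sequence:
  fixes z :: "nat \<Rightarrow> nat \<Rightarrow> real" and s :: real
  assumes s: "s > 1"
  shows "AE x in lborel. \<exists>k::nat. \<forall>i j.
    1 / ((real k + 1) * ((real i + 1) powr s * (real j + 1) powr s)) \<le> \<bar>x - z i j\<bar>"
proof -
  define w where "w i = (real i + 1) powr (-s)" for i :: nat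
  have wpos: "w i > 0" for i by (simp add: w_def)
  have sw: "summable w"
  proof -
    have "summable (\<lambda>n. real (Suc n) powr (-s))"
      using s by (subst summable_Suc_iff) (simp add: summable_real_powr_iff)
    then show ?thesis by (simp add: w_def [abs_def] add.commute)
  qed
  define W where "W = suminf w"
  have W0: "W \<ge> 0" unfolding W_def by (intro suminf_nonneg sw less_imp_le wpos)
  have sumw: "(\<Sum>i. ennreal (c * w i)) = ennreal (c * W)" if "c \<ge> 0" for c
    using that wpos sw by (subst suminf_ennreal2) (auto simp: W_def suminf_mult less_imp_le intro: summable_mult)
  define B where "B k = (\<Union>i j. {z i j - w i * w j / (real k + 1) <..< z i j + w i * w j / (real k + 1)})" for k :: nat
  have em: "emeasure lborel (B k) \<le> ennreal (2 * W * W / (real k + 1))" for k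
  proof -
    have inner: "emeasure lborel (\<Union>j. {z i j - w i * w j / (real k + 1) <..< z i j + w i * w j / (real k + 1)})
        \<le> ennreal ((2 * W / (real k + 1)) * w i)" (is "emeasure lborel (\<Union>j. ?I j) \<le> _") for i
    proof -
      have "emeasure lborel (\<Union>j. ?I j) \<le> (\<Sum>j. emeasure lborel (?I j))"
        by (intro emeasure_subadditive_countably) auto
      also have "\<dots> = (\<Sum>j. ennreal ((2 * w i / (real k + 1)) * w j))"
      proof (intro suminf_cong)
        fix j
        have "0 \<le> w i * w j / (real k + 1)" using wpos[THEN less_imp_le] by simp
        then have "emeasure lborel (?I j) = ennreal (2 * (w i * w j / (real k + 1)))"
          by (subst emeasure_lborel_Ioo) (linarith, simp)
        then show "emeasure lborel (?I j) = ennreal ((2 * w i / (real k + 1)) * w j)"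
          by (simp add: mult_ac)
      qed
      also have "\<dots> = ennreal ((2 * W / (real k + 1)) * w i)"
        using wpos[THEN less_imp_le, of i] by (subst sumw) (auto simp: mult_ac)
      finally show ?thesis .
    qed
    have "emeasure lborel (B k) \<le> (\<Sum>i. emeasure lborel (\<Union>j. {z i j - w i * w j / (real k + 1) <..< z i j + w i * w j / (real k + 1)}))"
      unfolding B_def by (intro emeasure_subadditive_countably) auto
    also have "\<dots> \<le> (\<Sum>i. ennreal ((2 * W / (real k + 1)) * w i))"
      by (intro suminf_le inner) auto
    also have "\<dots> = ennreal (2 * W * W / (real k + 1))"
      using W0 by (subst sumw) auto
    finally show ?thesis .
  qed
  have Bm: "B k \<in> sets lborel" for k by (auto simp: B_def)
  have Nm: "(\<Inter>k. B k) \<in> sets lborel" using Bm by blast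
  have "emeasure lborel (\<Inter>k. B k) \<le> 0"
  proof (rule LIMSEQ_le_const)
    have "(\<lambda>k. 2 * W * W / (real k + 1)) \<longlonglongrightarrow> 0" by real_asymp
    then show "(\<lambda>k. ennreal (2 * W * W / (real k + 1))) \<longlonglongrightarrow> 0"
      by (metis ennreal_0 tendsto_ennrealI)
    show "\<exists>N. \<forall>n\<ge>N. emeasure lborel (\<Inter>k. B k) \<le> ennreal (2 * W * W / (real n + 1))"
      using em Bm by (meson INT_lower UNIV_I emeasure_mono order_trans)
  qed
  then have "(\<Inter>k. B k) \<in> null_sets lborel" using Nm by auto
  then have "AE x in lborel. x \<notin> (\<Inter>k. B k)" by (rule AE_not_in)
  then show ?thesis
  proof eventually_elim
    case (elim x)
    then obtain k where k: "x \<notin> B k" by auto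
    have "1 / ((real k + 1) * ((real i + 1) powr s * (real j + 1) powr s)) \<le> \<bar>x - z i j\<bar>" for i j
    proof -
      have "w i * w j / (real k + 1) = 1 / ((real k + 1) * ((real i + 1) powr s * (real j + 1) powr s))"
        by (simp add: w_def powr_minus field_simps)
      moreover have "\<not> (z i j - w i * w j / (real k + 1) < x \<and> x < z i j + w i * w j / (real k + 1))"
        using k by (auto simp: B_def)
      ultimately show ?thesis by auto
    qed
    then show ?case by blast
  qed
qed

section \<open>Discrepancy of visit counts of a circle rotation\<close>

text \<open>The Birkhoff sum of the indicator of the arc [0, h) under rotation by \<theta> on the
  circle of length 1. The circle of length L is rescaled to it: \<theta> becomes t / L and h becomes
  1 / L.\<close>

definition visits :: "real \<Rightarrow> real \<Rightarrow> real \<Rightarrow> nat \<Rightarrow> real" where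
  "visits \<theta> h u N = (\<Sum>k<N. of_bool (frac (u + real k * \<theta>) < h))"

lemma visits_0 [simp]: "visits \<theta> h u 0 = 0"
  by (simp add: visits_def)

lemma visits_Suc: "visits \<theta> h u (Suc N) = visits \<theta> h u N + of_bool (frac (u + real N * \<theta>) < h)"
  by (simp add: visits_def)

lemma visits_add: "visits \<theta> h u (N + M) = visits \<theta> h u N + visits \<theta> h (u + real N * \<theta>) M"
  by (induction M) (simp_all add: visits_Suc algebra_simps)

text \<open>Multiplication by \<open>p\<close> is injective modulo \<open>q\<close>, and the set is
  finite. This assigns to each of q consecutive orbit points its own multiple of 1/q.\<close>

lemma bij_betw_affine_mod:
  fixes p m :: int and q :: nat
  assumes "q > 0" "coprime p (int q)"
  shows "bij_betw (\<lambda>k. nat ((int k * p + m) mod int q)) {..<q} {..<q}"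
proof -
  let ?J = "\<lambda>k::nat. nat ((int k * p + m) mod int q)"
  have "inj_on ?J {..<q}"
  proof
    fix k l assume kl: "k \<in> {..<q}" "l \<in> {..<q}" and eq: "?J k = ?J l"
    have "(int k * p + m) mod int q = (int l * p + m) mod int q"
      using eq assms(1) by (subst (asm) nat_eq_iff) simp
    then have "int q dvd (int k * p + m) - (int l * p + m)" by (rule mod_eq_dvd_iff[THEN iffD1])
    then have "int q dvd (int k - int l) * p" by (simp add: algebra_simps)
    then have d: "int q dvd int k - int l"
      using assms by (simp add: coprime_commute coprime_dvd_mult_left_iff)
    have "\<bar>int k - int l\<bar> < int q" using kl by auto
    moreover have "\<bar>int q\<bar> \<le> \<bar>int k - int l\<bar>" if "int k - int l \<noteq> 0"
      using d that by (rule dvd_imp_le_int[rotated])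
    ultimately have "int k - int l = 0" by linarith
    then show "k = l" by simp
  qed
  moreover have "?J ` {..<q} \<subseteq> {..<q}"
    using assms by (auto simp: nat_less_iff)
  ultimately show ?thesis
    by (simp add: bij_betw_def card_image card_subset_eq)
qed

text \<open>Denjoy--Koksma: the q orbit points lie within 2/q of distinct multiples of 1/q,
  so only those near the endpoints of [0, h) can be miscounted.\<close>
lemma visits_block:
  fixes p :: int and q :: nat
  assumes q: "q > 0" and cop: "coprime p (int q)" and appr: "\<bar>real q * \<theta> - of_int p\<bar> \<le> 1 / real q"
    and h: "0 \<le> h" "h \<le> 1"
  shows "\<bar>visits \<theta> h u q - real q * h\<bar> \<le> 3"
proof -
  \<comment> \<open>The grid point m / q lies just below u, so the k-th orbit point is close to
    \<open>J k / q\<close> modulo 1.\<close>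
  define m where "m = \<lfloor>real q * u\<rfloor>"
  define J where "J k = nat ((int k * p + m) mod int q)" for k
  have bij: "bij_betw J {..<q} {..<q}"
    unfolding J_def by (rule bij_betw_affine_mod[OF q cop])
  define S where "S = {k\<in>{..<q}. frac (u + real k * \<theta>) < h}"
  have vis: "visits \<theta> h u q = real (card S)"
    by (simp add: visits_def S_def of_bool_def sum.If_cases Int_def)
  have cJ: "card S = card (J ` S)"
    by (subst card_image) (auto intro: inj_on_subset[OF bij_betw_imp_inj_on[OF bij]] simp: S_def)
  have key: "\<exists>e. frac (u + real k * \<theta>) = frac ((real (J k) + e) / real q) \<and> -1 < e \<and> e < 2" if "k < q" for k
  proof -
    define d where "d = real q * \<theta> - of_int p"
    \<comment> \<open>q times the offset from the grid point: rounding u contributes a value in [0,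
      1), and replacing \<theta> by p / q one in (-1, 1), because k < q.\<close>
    define e where "e = frac (real q * u) + real k * d"
    have "\<bar>real k * d\<bar> < 1"
    proof -
      have "\<bar>real k * d\<bar> \<le> real k * (1 / real q)"
        using appr by (simp add: d_def abs_mult mult_left_mono del: times_divide_eq_right)
      also have "\<dots> < 1" using that by simp
      finally show ?thesis .
    qed
    then have e: "-1 < e" "e < 2"
      using frac_ge_0[of "real q * u"] frac_lt_1[of "real q * u"] unfolding e_def by linarith+
    define t where "t = (int k * p + m) div int q"
    have "int k * p + m = int (J k) + int q * t"
      using q by (simp add: J_def t_def)
    then have Jt: "real k * of_int p + of_int m = real (J k) + real q * of_int t"
      by (metis of_int_add of_int_mult of_int_of_nat_eq)
    have "real q * (u + real k * \<theta>) = real k * of_int p + of_int m + e"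
      by (simp add: e_def d_def m_def frac_def algebra_simps)
    also have "\<dots> = real q * ((real (J k) + e) / real q + of_int t)"
      unfolding Jt distrib_left using q by simp
    finally have "u + real k * \<theta> = (real (J k) + e) / real q + of_int t"
      using q by simp
    then have "frac (u + real k * \<theta>) = frac ((real (J k) + e) / real q)"
      by (simp add: frac_def)
    with e show ?thesis by blast
  qed
  \<comment> \<open>Since e > -1, a hit needs j < q h + 1. Only j = q - 1 escapes this reasoning,
    because its point may pass 1 and wrap around to 0.\<close>
  have up: "J ` S \<subseteq> insert (q - 1) {..<nat \<lceil>real q * h + 1\<rceil>}"
  proof
    fix j assume "j \<in> J ` S"
    then obtain k where k: "k < q" "frac (u + real k * \<theta>) < h" "j = J k" by (auto simp: S_def)
    obtain e where e: "frac (u + real k * \<theta>) = frac ((real (J k) + e) / real q)" "-1 < e" "e < 2"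
      using key[OF k(1)] by blast
    have jq: "j < q" using k bij bij_betwE by fastforce
    show "j \<in> insert (q - 1) {..<nat \<lceil>real q * h + 1\<rceil>}"
    proof (cases "j = q - 1")
      case False
      then have j2: "real j + 2 \<le> real q" using jq by linarith
      have "real j < real q * h + 1"
      proof (cases "real j + e \<ge> 0")
        case True
        have "frac ((real j + e) / real q) = (real j + e) / real q"
          using True j2 e q by (subst frac_eq) auto
        then have "(real j + e) / real q < h" using k e by simp
        then have "real j + e < real q * h" using q by (simp add: field_simps)
        then show ?thesis using e by linarith
      next
        case False
        then have "j = 0" using e by linarith
        then show ?thesis using h by (simp add: add_nonneg_pos)
      qed
      then have "j < nat \<lceil>real q * h + 1\<rceil>" by linarith
      then show ?thesis by simp
    qed simp
  qed
  have "card (J ` S) \<le> card (insert (q - 1) {..<nat \<lceil>real q * h + 1\<rceil>})"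
    by (rule card_mono[OF _ up]) simp
  also have "\<dots> \<le> Suc (nat \<lceil>real q * h + 1\<rceil>)"
    using card_insert_le_m1 by (simp add: card_insert_if)
  finally have "card S \<le> Suc (nat \<lceil>real q * h + 1\<rceil>)" using cJ by simp
  moreover have "0 \<le> real q * h" using h by simp
  ultimately have U: "real (card S) \<le> real q * h + 3" by linarith
  \<comment> \<open>Starting at 1 rules out wrapping below 0, and the margin 2 absorbs e <
    2.\<close>
  have lo: "{1..nat \<lfloor>real q * h - 2\<rfloor>} \<subseteq> J ` S"
  proof
    fix j assume j: "j \<in> {1..nat \<lfloor>real q * h - 2\<rfloor>}"
    then have j1: "1 \<le> real j" and j2: "real j + 2 \<le> real q * h"
      unfolding atLeastAtMost_iff by linarith+
    have "real q * h \<le> real q" using h by (simp add: mult_left_le)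
    then have "j < q" using j2 by linarith
    then obtain k where k: "k < q" "J k = j" using bij by (metis bij_betw_imp_surj_on image_iff lessThan_iff)
    obtain e where e: "frac (u + real k * \<theta>) = frac ((real (J k) + e) / real q)" "-1 < e" "e < 2"
      using key[OF k(1)] by blast
    have lt: "(real j + e) / real q < h" using q j2 e by (simp add: field_simps)
    have "frac ((real j + e) / real q) = (real j + e) / real q"
    proof (rule frac_eq[THEN iffD2], intro conjI)
      show "0 \<le> (real j + e) / real q" using j1 e by (intro divide_nonneg_nonneg) auto
      show "(real j + e) / real q < 1" using lt h by linarith
    qed
    then show "j \<in> J ` S" using k e lt by (auto simp: S_def)
  qed
  have "card {1..nat \<lfloor>real q * h - 2\<rfloor>} \<le> card (J ` S)"
    by (rule card_mono[OF _ lo]) (simp add: S_def)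
  then have "nat \<lfloor>real q * h - 2\<rfloor> \<le> card S" using cJ by simp
  then have L: "real q * h - 3 \<le> real (card S)" by linarith
  show ?thesis using U L vis by simp
qed

text \<open>The bound for one block is uniform in the starting point, so it applies to every
  consecutive block and the errors add up.\<close>

lemma visits_blocks:
  fixes p :: int and q :: nat
  assumes "q > 0" "coprime p (int q)" "\<bar>real q * \<theta> - of_int p\<bar> \<le> 1 / real q" "0 \<le> h" "h \<le> 1"
  shows "\<bar>visits \<theta> h u (k * q) - real (k * q) * h\<bar> \<le> 3 * real k"
proof (induction k)
  case (Suc k)
  have "visits \<theta> h u (Suc k * q) = visits \<theta> h u (k * q) + visits \<theta> h (u + real (k * q) * \<theta>) q"
    using visits_add[of \<theta> h u "k * q" q] by (simp add: add.commute)
  then show ?case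
    using Suc visits_block[OF assms, of "u + real (k * q) * \<theta>"]
    by (simp add: algebra_simps abs_le_iff)
qed simp

text \<open>Dirichlet's theorem gives a block length q between a multiple of N^(1-e) and N; the remainder
  N mod q is at most N / 2, so the bounds sum to a geometric series.\<close>
lemma visits_diophantine:
  fixes \<theta> h \<delta> \<epsilon> :: real
  assumes dio: "\<And>(q::nat) (p::int). q \<ge> 1 \<Longrightarrow> \<delta> * real q powr (-1-\<epsilon>) \<le> \<bar>real q * \<theta> - of_int p\<bar>"
    and pos: "\<delta> > 0" "\<epsilon> > 0" and h: "0 \<le> h" "h \<le> 1"
  shows "\<bar>visits \<theta> h u N - real N * h\<bar> \<le> 3 / \<delta> / (1 - 2 powr -\<epsilon>) * real N powr \<epsilon>"
proof -
  define K where "K = 3 / \<delta> / (1 - 2 powr -\<epsilon>)"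
  have e1: "2 powr -\<epsilon> < 1" using pos by (simp add: powr_less_one)
  have K0: "K \<ge> 0" using e1 pos by (simp add: K_def)
  \<comment> \<open>\<open>K\<close> is the fixed point of the recursion below: 3/\<delta> pays for
    the full blocks and the other term for the remainder.\<close>
  have KK: "3 / \<delta> + K * 2 powr -\<epsilon> = K"
  proof -
    have "1 - 2 powr -\<epsilon> \<noteq> 0" using e1 by linarith
    then have "K * (1 - 2 powr -\<epsilon>) = 3 / \<delta>"
      unfolding K_def by (rule nonzero_eq_divide_eq[THEN iffD1, OF _ refl])
    then show ?thesis by (simp add: algebra_simps)
  qed
  have "\<bar>visits \<theta> h u N - real N * h\<bar> \<le> K * real N powr \<epsilon>"
  proof (induction N arbitrary: u rule: less_induct)
    case (less N)
    show ?case
    proof (cases "N = 0")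
      case False
      then have N: "N > 0" by simp
      obtain p k where pk: "coprime p k" "0 < k" "k \<le> int N" "\<bar>of_int k * \<theta> - of_int p\<bar> < 1 / real N"
        using Dirichlet_approx_coprime[OF N] by metis
      define q where "q = nat k"
      have q: "q > 0" "q \<le> N" "coprime p (int q)" "\<bar>real q * \<theta> - of_int p\<bar> < 1 / real N"
        using pk by (auto simp: q_def)
      have "1 / real N \<le> 1 / real q" using q by (simp add: frac_le)
      then have q': "\<bar>real q * \<theta> - of_int p\<bar> \<le> 1 / real q" using q by linarith
      define r where "r = N mod q"
      define d where "d = N div q"
      have Ndr: "N = d * q + r" by (simp add: d_def r_def)
      have d1: "d \<ge> 1" using q by (simp add: d_def div_greater_zero_iff Suc_le_eq)
      have rq: "r < q" using q by (simp add: r_def)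
      have "1 * q \<le> d * q" using d1 by (rule mult_le_mono1)
      then have r2: "2 * r \<le> N" using Ndr rq by linarith
      have rN: "r < N" using rq q by simp
      \<comment> \<open>Dirichlet's upper bound 1/N meets the Diophantine lower bound; hence q
        cannot be small and there are at most O(N powr \<epsilon>) blocks.\<close>
      have "\<delta> * real q powr (-1-\<epsilon>) < 1 / real N" using dio[of q p] q by linarith
      then have "real N / real q < real q powr \<epsilon> / \<delta>"
        using N q pos by (simp add: powr_diff powr_minus field_simps)
      moreover have "real d \<le> real N / real q"
        unfolding d_def by (rule of_nat_div_le_of_nat)
      moreover have "real q powr \<epsilon> / \<delta> \<le> real N powr \<epsilon> / \<delta>"
        using q pos by (intro divide_right_mono powr_mono2) auto
      ultimately have d: "real d \<le> real N powr \<epsilon> / \<delta>" by linarith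
      define u' where "u' = u + real (d * q) * \<theta>"
      have A: "\<bar>visits \<theta> h u (d * q) - real (d * q) * h\<bar> \<le> 3 * real d"
        by (rule visits_blocks[OF q(1) q(3) q' h])
      have "\<bar>visits \<theta> h u' r - real r * h\<bar> \<le> K * real r powr \<epsilon>"
        by (rule less.IH[OF rN])
      also have "\<dots> \<le> K * (real N / 2) powr \<epsilon>"
        using r2 pos K0 by (intro mult_left_mono powr_mono2) auto
      also have "\<dots> = K * 2 powr -\<epsilon> * real N powr \<epsilon>"
        by (simp add: powr_divide powr_minus field_simps)
      finally have B: "\<bar>visits \<theta> h u' r - real r * h\<bar> \<le> K * 2 powr -\<epsilon> * real N powr \<epsilon>" .
      have "visits \<theta> h u N = visits \<theta> h u (d * q) + visits \<theta> h u' r"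
        unfolding u'_def by (subst Ndr) (rule visits_add)
      moreover have "real N * h = real (d * q) * h + real r * h"
        by (subst Ndr) (simp add: algebra_simps)
      ultimately have "\<bar>visits \<theta> h u N - real N * h\<bar> \<le> 3 * real d + K * 2 powr -\<epsilon> * real N powr \<epsilon>"
        using A B by linarith
      also have "\<dots> \<le> (3 / \<delta> + K * 2 powr -\<epsilon>) * real N powr \<epsilon>"
        using d by (simp add: algebra_simps)
      finally show ?thesis by (simp only: KK)
    qed simp
  qed
  then show ?thesis by (simp add: K_def)
qed


section \<open>The null sets of length vectors and of pairs of points\<close>

text \<open>For fixed b, the number a has to avoid the values at which (1 - a) / (1 + b) equals j /
  (i + 1); Fubini does the rest. Quantifying over \<open>e\<close> inside covers exponents
  arbitrarily close to 1 by a single null set.\<close>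

lemma AE_rotation_diophantine:
  "AE p in (lborel :: (real \<times> real) measure). \<forall>e::nat. \<exists>k::nat. \<forall>i j.
     1 / ((real k + 1) * ((real i + 1) powr (1 + 1 / (real e + 1)) * (real j + 1) powr (1 + 1 / (real e + 1))))
       \<le> \<bar>fst p - (1 - real j * (1 + snd p) / (real i + 1))\<bar>"
proof -
  let ?P = "\<lambda>a b. \<forall>e::nat. \<exists>k::nat. \<forall>i j.
     1 / ((real k + 1) * ((real i + 1) powr (1 + 1 / (real e + 1)) * (real j + 1) powr (1 + 1 / (real e + 1))))
       \<le> \<bar>a - (1 - real j * (1 + b) / (real i + 1))\<bar>"
  have meas: "{x \<in> space (lborel \<Otimes>\<^sub>M lborel). ?P (fst x) (snd x)} \<in> sets (lborel \<Otimes>\<^sub>M lborel)"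
    by measurable
  have "AE a in lborel. ?P a b" for b
    unfolding AE_all_countable by (intro allI AE_far_from_double_sequence) simp
  \<comment> \<open>The null slices run along a, while \<open>AE_pair_iff\<close> puts the first
    coordinate outermost; hence the exchange of the two quantifiers.\<close>
  then have "AE b in lborel. AE a in lborel. ?P a b" by (rule AE_I2)
  then have "AE a in lborel. AE b in lborel. ?P a b"
    by (subst lborel_pair.AE_commute[OF meas])
  then have "AE x in lborel \<Otimes>\<^sub>M lborel. ?P (fst x) (snd x)"
    by (subst lborel_pair.AE_pair_iff[OF meas, symmetric])
  then show ?thesis by (simp only: lborel_prod)
qed

text \<open>For fixed x, the point y has to avoid the points x + m t - m' L. Any exponent above 1
  would do here; 2 is convenient. The terms 2 |m| + 1 come from enumerating the integers by
  \<open>int_decode\<close>.\<close>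

lemma AE_difference_far_from_lattice:
  fixes t L :: real
  shows "AE q in (lborel :: (real \<times> real) measure). \<exists>k::nat. \<forall>m m' :: int.
     1 / ((real k + 1) * ((2 * \<bar>of_int m\<bar> + 1)\<^sup>2 * (2 * \<bar>of_int m'\<bar> + 1)\<^sup>2))
       \<le> \<bar>fst q - snd q + of_int m * t - of_int m' * L\<bar>"
proof -
  let ?P = "\<lambda>x y. \<exists>k::nat. \<forall>i j.
     1 / ((real k + 1) * ((real i + 1) powr 2 * (real j + 1) powr 2))
       \<le> \<bar>y - (x + of_int (int_decode i) * t - of_int (int_decode j) * L)\<bar>"
  have meas: "{x \<in> space (lborel \<Otimes>\<^sub>M lborel). ?P (fst x) (snd x)} \<in> sets (lborel \<Otimes>\<^sub>M lborel)"
    by measurable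
  have "AE x in lborel. AE y in lborel. ?P x y"
    by (intro AE_I2 AE_far_from_double_sequence) simp
  then have "AE x in lborel \<Otimes>\<^sub>M lborel. ?P (fst x) (snd x)"
    by (subst lborel_pair.AE_pair_iff[OF meas, symmetric])
  then have "AE q in (lborel :: (real \<times> real) measure). ?P (fst q) (snd q)"
    by (simp only: lborel_prod)
  then show ?thesis
  proof eventually_elim
    case (elim q)
    then obtain k where k: "\<And>i j. 1 / ((real k + 1) * ((real i + 1) powr 2 * (real j + 1) powr 2))
       \<le> \<bar>snd q - (fst q + of_int (int_decode i) * t - of_int (int_decode j) * L)\<bar>" by blast
    have enc: "real (int_encode m) \<le> 2 * \<bar>of_int m\<bar>" for m
      by (auto simp: int_encode_def sum_encode_def)
    have "1 / ((real k + 1) * ((2 * \<bar>of_int m\<bar> + 1)\<^sup>2 * (2 * \<bar>of_int m'\<bar> + 1)\<^sup>2))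
       \<le> \<bar>fst q - snd q + of_int m * t - of_int m' * L\<bar>" for m m' :: int
    proof -
      have "1 / ((real k + 1) * ((2 * \<bar>of_int m\<bar> + 1)\<^sup>2 * (2 * \<bar>of_int m'\<bar> + 1)\<^sup>2))
        \<le> 1 / ((real k + 1) * ((real (int_encode m) + 1)\<^sup>2 * (real (int_encode m') + 1)\<^sup>2))"
        using enc[of m] enc[of m']
        by (intro divide_left_mono mult_left_mono mult_mono power_mono) auto
      also have "\<dots> \<le> \<bar>snd q - (fst q + of_int m * t - of_int m' * L)\<bar>"
        using k[of "int_encode m" "int_encode m'"] by simp
      also have "\<dots> = \<bar>fst q - snd q + of_int m * t - of_int m' * L\<bar>" by linarith
      finally show ?thesis .
    qed
    then show ?case by blast
  qed
qed

section \<open>The interval exchange as a first return map of a rotation\<close>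

text \<open>The translations are written as integer combinations of t = 1 - a and L = 1 + b, namely
  t, 2 t - L and t - L, to exhibit the rotation.\<close>

lemma iet_321:
  assumes "a > 0" "b > 0" "a + b < 1" "0 \<le> x" "x < 1"
  shows "iet 3 (\<lambda>k. 4 - k) (len3 a b) x =
    (if x < a then x + (1 - a) else if x < a + b then x + 2 * (1 - a) - (1 + b) else x + (1 - a) - (1 + b))"
proof -
  have 3: "{1..3} = {1,2,3::nat}" and 2: "{1..2} = {1,2::nat}" by auto
  have l: "{1..<1} = ({}::nat set)" "{1..<2} = {1::nat}" "{1..<3} = {1,2::nat}" by auto
  have p: "{i'\<in>{1,2,3::nat}. 4 - i' < 4 - 1} = {2,3}" "{i'\<in>{1,2,3::nat}. 4 - i' < 4 - 2} = {3}"
    "{i'\<in>{1,2,3::nat}. 4 - i' < 4 - 3} = {}" by auto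
  have s: "iet_s (len3 a b) 0 = 0" "iet_s (len3 a b) 1 = a" "iet_s (len3 a b) 2 = a + b" "iet_s (len3 a b) 3 = 1"
    by (simp_all add: iet_s_def len3_def 2 3 del: One_nat_def)
  have d: "1 - 1 = (0::nat)" "2 - 1 = (1::nat)" "3 - 1 = (2::nat)" by auto
  have ne: "(1::nat) \<noteq> 2" "(1::nat) \<noteq> 3" "(2::nat) \<noteq> 3" by auto
  have sum3: "sum f {1,2,3::nat} = f 1 + f 2 + f 3" for f :: "nat \<Rightarrow> real" by simp
  show ?thesis
    unfolding iet_def 3 sum3 l p s d using assms by (simp add: len3_def)
qed

text \<open>N counts rotation steps and M full turns. One step of \<open>T\<close> costs one
  rotation step, or two when the orbit passes through [1, L); hence N \<le> 2 n. Counting starts at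
  x + t, so that the initial point is left out and the visits number exactly n.\<close>

lemma iet_321_orbit:
  fixes a b x :: real
  defines "T \<equiv> iet 3 (\<lambda>k. 4 - k) (len3 a b)" and "L \<equiv> 1 + b" and "t \<equiv> 1 - a"
  assumes ab: "a > 0" "b > 0" "a + b < 1" and x: "0 \<le> x" "x < 1"
  shows "\<exists>(N::nat) (M::nat). N \<le> 2 * n \<and> (T ^^ n) x = x + real N * t - real M * L \<and>
     0 \<le> (T ^^ n) x \<and> (T ^^ n) x < 1 \<and> visits (t / L) (1 / L) ((x + t) / L) N = real n"
proof (induction n)
  case 0
  then show ?case using x by (intro exI[of _ 0]) auto
next
  case (Suc n)
  then obtain N M :: nat where N: "N \<le> 2 * n" and eq: "(T ^^ n) x = x + real N * t - real M * L"
    and I: "0 \<le> (T ^^ n) x" "(T ^^ n) x < 1" and v: "visits (t / L) (1 / L) ((x + t) / L) N = real n"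
    by blast
  define z where "z = (T ^^ n) x"
  have L: "L > 0" "L > 1" using ab by (auto simp: L_def)
  have t: "a + t = 1" "b < t" "L = 1 + b" using ab by (auto simp: t_def L_def)
  have Tz: "(T ^^ Suc n) x = (if z < a then z + t else if z < a + b then z + 2 * t - L else z + t - L)"
    using iet_321[OF ab, of z] I by (simp add: T_def z_def t_def L_def)
  have z: "0 \<le> z" "z < 1" "z = x + real N * t - real M * L" using I eq by (auto simp: z_def)
  \<comment> \<open>Division by L turns the circle of length L into that of length 1; y is the
    representative in [0, L) after removing m turns.\<close>
  have fr: "frac ((x + t) / L + real k * (t / L)) < 1 / L \<longleftrightarrow> y < 1"
    if "x + t + real k * t = y + real m * L" "0 \<le> y" "y < L" for k m :: nat and y
  proof -
    have "(x + t) / L + real k * (t / L) = (x + t + real k * t) / L" using L by (simp add: add_divide_distrib)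
    also have "\<dots> = y / L + of_int (int m)" using L unfolding that(1) by (simp add: add_divide_distrib)
    finally have "frac ((x + t) / L + real k * (t / L)) = frac (y / L)" by (simp add: frac_def)
    also have "\<dots> = y / L" using that L by (subst frac_eq) auto
    finally show ?thesis using L by (simp add: divide_less_cancel)
  qed
  have zN: "x + t + real N * t = z + t + real M * L" using z(3) by simp
  consider "z < a" | "a \<le> z" "z < a + b" | "a + b \<le> z" by linarith
  then show ?case
  proof cases
    case 1
    have "frac ((x + t) / L + real N * (t / L)) < 1 / L \<longleftrightarrow> z + t < 1"
      using 1 z(1,2) L t ab zN by (intro fr[of N _ M]) linarith+
    then have v': "visits (t / L) (1 / L) ((x + t) / L) (N + 1) = real (Suc n)"
      using v 1 t by (simp add: visits_Suc)
    have T: "(T ^^ Suc n) x = z + t" using 1 by (simp only: Tz if_True)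
    have "z + t = x + real (N + 1) * t - real M * L" using z(3) by (simp add: algebra_simps)
    moreover have "N + 1 \<le> 2 * Suc n" using N by simp
    moreover have "0 \<le> z + t" "z + t < 1" using 1 z(1) t ab by linarith+
    ultimately show ?thesis using v' unfolding T by blast
  next
    case 2
    \<comment> \<open>On the middle interval z + t lies in [1, L), which is no visit, and the next
      rotation step returns to [0, 1).\<close>
    have "frac ((x + t) / L + real N * (t / L)) < 1 / L \<longleftrightarrow> z + t < 1"
      using 2 z(1,2) L t ab zN by (intro fr[of N _ M]) linarith+
    moreover have "frac ((x + t) / L + real (N + 1) * (t / L)) < 1 / L \<longleftrightarrow> z + 2 * t - L < 1"
    proof (rule fr[of "N + 1" _ "M + 1"])
      show "x + t + real (N + 1) * t = z + 2 * t - L + real (M + 1) * L"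
        using zN by (simp add: algebra_simps)
    qed (use 2 z(1,2) L t ab in linarith)+
    ultimately have v': "visits (t / L) (1 / L) ((x + t) / L) (N + 2) = real (Suc n)"
      using v 2 t ab visits_Suc[of "t / L" "1 / L" "(x + t) / L" N] visits_Suc[of "t / L" "1 / L" "(x + t) / L" "N + 1"]
      by simp
    have T: "(T ^^ Suc n) x = z + 2 * t - L" unfolding Tz using 2 by auto
    have "z + 2 * t - L = x + real (N + 2) * t - real (M + 1) * L" using z(3) by (simp add: algebra_simps)
    moreover have "N + 2 \<le> 2 * Suc n" using N by simp
    moreover have "0 \<le> z + 2 * t - L" "z + 2 * t - L < 1" using 2 z(1) t ab by linarith+
    ultimately show ?thesis using v' unfolding T by blast
  next
    case 3
    \<comment> \<open>Here z + t \<ge> L, so a single step completes a turn and lands in [0, 1) at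
      once.\<close>
    have "frac ((x + t) / L + real N * (t / L)) < 1 / L \<longleftrightarrow> z + t - L < 1"
    proof (rule fr[of N _ "M + 1"])
      show "x + t + real N * t = z + t - L + real (M + 1) * L"
        using zN by (simp add: algebra_simps)
    qed (use 3 z(1,2) L t ab in linarith)+
    then have v': "visits (t / L) (1 / L) ((x + t) / L) (N + 1) = real (Suc n)"
      using v 3 z(2) t ab by (simp add: visits_Suc)
    have T: "(T ^^ Suc n) x = z + t - L" unfolding Tz using 3 ab by auto
    have "z + t - L = x + real (N + 1) * t - real (M + 1) * L" using z(3) by (simp add: algebra_simps)
    moreover have "N + 1 \<le> 2 * Suc n" using N by simp
    moreover have "0 \<le> z + t - L" "z + t - L < 1" using 3 z(1,2) t ab by linarith+
    ultimately show ?thesis using v' unfolding T by blast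
  qed
qed


section \<open>Diophantine rotation number and separation of two orbits\<close>

text \<open>The distance from a to the value giving \<theta> = p / q is (1 + b) / q times |q
  \<theta> - p|. For 0 \<le> p \<le> q both weights in \<open>far\<close> are powers of q up to a
  constant; any other p is at distance at least 1, since 0 < \<theta> < 1.\<close>

lemma rotation_diophantine:
  fixes a b \<eta> :: real and p :: int and q :: nat
  assumes ab: "a > 0" "b > 0" "a + b < 1" and \<eta>: "\<eta> > 0" and q: "q \<ge> 1"
    and far: "\<And>i j. 1 / ((real k + 1) * ((real i + 1) powr (1 + \<eta>) * (real j + 1) powr (1 + \<eta>)))
       \<le> \<bar>a - (1 - real j * (1 + b) / (real i + 1))\<bar>"
  shows "1 / ((real k + 1) * 2 powr (2 + \<eta>)) * real q powr (-1 - 2 * \<eta>)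
    \<le> \<bar>real q * ((1 - a) / (1 + b)) - of_int p\<bar>" (is "?l \<le> ?r")
proof -
  define \<theta> where "\<theta> = (1 - a) / (1 + b)"
  have th: "0 < \<theta>" "\<theta> < 1" "\<theta> * (1 + b) = 1 - a" using ab by (simp_all add: \<theta>_def)
  have l1: "?l \<le> 1"
  proof -
    have "1 \<le> (2::real) powr (2 + \<eta>)" using \<eta> by (intro ge_one_powr_ge_zero) auto
    then have "1 * 1 \<le> (real k + 1) * 2 powr (2 + \<eta>)" by (intro mult_mono) auto
    moreover have "real q powr (-1 - 2 * \<eta>) \<le> real q powr 0" using q \<eta> by (intro powr_mono) auto
    ultimately have "?l \<le> 1 * 1" using q by (intro mult_mono) auto
    then show ?thesis by simp
  qed
  have q\<theta>: "0 < real q * \<theta>" "real q * \<theta> < real q" using th q by auto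
  consider "p < 0" | "p > int q" | "0 \<le> p" "p \<le> int q" by linarith
  then show ?thesis
  proof cases
    case 1
    then have "1 \<le> \<bar>real q * \<theta> - of_int p\<bar>" using q\<theta> by linarith
    with l1 show ?thesis unfolding \<theta>_def by linarith
  next
    case 2
    then have "1 \<le> \<bar>real q * \<theta> - of_int p\<bar>" using q\<theta> by linarith
    with l1 show ?thesis unfolding \<theta>_def by linarith
  next
    case 3
    define i where "i = q - 1"
    define j where "j = nat p"
    have i: "real i + 1 = real q" using q by (simp add: i_def of_nat_diff)
    \<comment> \<open>The estimate j + 1 \<le> 2 q, together with (1 + b) / 2 \<le> 1 further down,
      produces the constant \<open>2 powr (2 + \<eta>)\<close>.\<close>
    have j: "real j = of_int p" "real j + 1 \<le> 2 * real q" using 3 q by (auto simp: j_def)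
    have "?l = real q / 2 * (1 / ((real k + 1) * (real q powr (1 + \<eta>) * (2 * real q) powr (1 + \<eta>))))"
    proof -
      have Q: "real q powr (-1 - 2 * \<eta>) = 1 / (real q * (real q powr \<eta> * real q powr \<eta>))"
      proof -
        have "real q powr (-1 - 2 * \<eta>) = real q powr (- (1 + (\<eta> + \<eta>)))" by simp
        also have "\<dots> = 1 / real q powr (1 + (\<eta> + \<eta>))" by (rule powr_minus_divide)
        finally show ?thesis using q by (simp only: powr_add) simp
      qed
      have Q1: "real q powr (1 + \<eta>) = real q * real q powr \<eta>"
        using q by (simp add: powr_add)
      have Q2: "(2 * real q) powr (1 + \<eta>) = 2 * real q * (2 powr \<eta> * real q powr \<eta>)"
        using q by (simp add: powr_add powr_mult)
      have Q3: "(2::real) powr (2 + \<eta>) = 4 * 2 powr \<eta>" by (simp add: powr_add)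
      show ?thesis unfolding Q Q1 Q2 Q3 using q by (simp del: distrib_right_numeral)
    qed
    also have "\<dots> \<le> real q / 2 * (1 / ((real k + 1) * ((real i + 1) powr (1 + \<eta>) * (real j + 1) powr (1 + \<eta>))))"
      using q j(2) \<eta> unfolding i
      by (intro mult_left_mono divide_left_mono powr_mono2 mult_pos_pos) auto
    also have "\<dots> \<le> real q / 2 * \<bar>a - (1 - real j * (1 + b) / real q)\<bar>"
      using far[of i j] unfolding i by (intro mult_left_mono) auto
    also have "\<bar>a - (1 - real j * (1 + b) / real q)\<bar> = (1 + b) / real q * \<bar>real q * \<theta> - of_int p\<bar>"
    proof -
      have "a - (1 - real j * (1 + b) / real q) = - ((1 + b) / real q * (real q * \<theta> - of_int p))"
      proof -
        have "(1 + b) / real q * (real q * \<theta> - of_int p) = \<theta> * (1 + b) - real j * (1 + b) / real q"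
          using q unfolding j(1) by (simp add: right_diff_distrib mult.commute)
        then show ?thesis unfolding th(3) by simp
      qed
      then show ?thesis using ab by (simp add: abs_mult)
    qed
    also have "real q / 2 * ((1 + b) / real q * \<bar>real q * \<theta> - of_int p\<bar>) = (1 + b) / 2 * \<bar>real q * \<theta> - of_int p\<bar>"
      using q by simp
    also have "\<dots> \<le> 1 * \<bar>real q * \<theta> - of_int p\<bar>"
      using ab by (intro mult_right_mono) auto
    finally show ?thesis by (simp add: \<theta>_def)
  qed
qed

text \<open>Both rotation times are L n up to O(n powr \<epsilon>), so they differ by an m of that
  size. Boundedness of the orbits forces the same for m', and the two squares in \<open>lat\<close>
  then give the exponent 4 \<epsilon>.\<close>

lemma iet_321_separation:
  fixes a b \<delta> \<epsilon> x y :: real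
  defines "T \<equiv> iet 3 (\<lambda>k. 4 - k) (len3 a b)" and "L \<equiv> 1 + b" and "t \<equiv> 1 - a"
  assumes ab: "a > 0" "b > 0" "a + b < 1" and pos: "\<delta> > 0" "\<epsilon> > 0"
    and dio: "\<And>(q::nat) (p::int). q \<ge> 1 \<Longrightarrow> \<delta> * real q powr (-1-\<epsilon>) \<le> \<bar>real q * (t / L) - of_int p\<bar>"
    and lat: "\<And>m m' :: int. 1 / ((real k + 1) * ((2 * \<bar>of_int m\<bar> + 1)\<^sup>2 * (2 * \<bar>of_int m'\<bar> + 1)\<^sup>2))
       \<le> \<bar>x - y + of_int m * t - of_int m' * L\<bar>"
    and xy: "0 \<le> x" "x < 1" "0 \<le> y" "y < 1"
  shows "\<exists>c>0. \<forall>n::nat. n \<ge> 1 \<longrightarrow> c * real n powr (-4 * \<epsilon>) \<le> \<bar>(T ^^ n) x - (T ^^ n) y\<bar>"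
proof -
  define K where "K = 3 / \<delta> / (1 - 2 powr -\<epsilon>)"
  have e1: "2 powr -\<epsilon> < 1" using pos by (simp add: powr_less_one)
  have K0: "K \<ge> 0" using e1 pos by (simp add: K_def)
  have L: "1 < L" "L < 2" and t: "0 < t" "t < 1" using ab by (auto simp: L_def t_def)
  \<comment> \<open>One factor 2 comes from L < 2, another from comparing two orbits, and
    \<open>2 powr \<epsilon>\<close> from N \<le> 2 n.\<close>
  define K' where "K' = 4 * K * 2 powr \<epsilon>"
  have K'0: "K' \<ge> 0" using K0 by (simp add: K'_def)
  define c where "c = 1 / ((real k + 1) * (2 * K' + 5) ^ 4)"
  have c: "c > 0" using K'0 by (simp add: c_def)
  have dens: "\<bar>real N - L * real n\<bar> \<le> K' / 2 * real n powr \<epsilon>"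
    if "N \<le> 2 * n" "visits (t / L) (1 / L) u N = real n" for N n u
  proof -
    have "\<bar>visits (t / L) (1 / L) u N - real N * (1 / L)\<bar> \<le> K * real N powr \<epsilon>"
      unfolding K_def by (rule visits_diophantine[OF dio pos]) (use L in auto)
    also have "\<dots> \<le> K * (2 * real n) powr \<epsilon>"
      using that(1) pos K0 by (intro mult_left_mono powr_mono2) auto
    finally have *: "\<bar>real n - real N * (1 / L)\<bar> \<le> K * (2 * real n) powr \<epsilon>" by (simp add: that(2))
    have "\<bar>real N - L * real n\<bar> = L * \<bar>real n - real N * (1 / L)\<bar>"
    proof -
      have "real N - L * real n = - (L * (real n - real N * (1 / L)))" using L by (simp add: field_simps)
      then show ?thesis using L by (simp add: abs_mult)
    qed
    also have "\<dots> \<le> 2 * (K * (2 * real n) powr \<epsilon>)"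
      using * L by (intro mult_mono) auto
    also have "\<dots> = K' / 2 * real n powr \<epsilon>" by (simp add: K'_def powr_mult)
    finally show ?thesis .
  qed
  have "c * real n powr (-4 * \<epsilon>) \<le> \<bar>(T ^^ n) x - (T ^^ n) y\<bar>" if n: "n \<ge> 1" for n
  proof -
    obtain N M :: nat where N: "N \<le> 2 * n" "(T ^^ n) x = x + real N * t - real M * L" "0 \<le> (T ^^ n) x" "(T ^^ n) x < 1"
      "visits (t / L) (1 / L) ((x + t) / L) N = real n"
      using iet_321_orbit[OF ab xy(1,2), of n] unfolding T_def L_def t_def by blast
    obtain N' M' :: nat where N': "N' \<le> 2 * n" "(T ^^ n) y = y + real N' * t - real M' * L" "0 \<le> (T ^^ n) y" "(T ^^ n) y < 1"
      "visits (t / L) (1 / L) ((y + t) / L) N' = real n"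
      using iet_321_orbit[OF ab xy(3,4), of n] unfolding T_def L_def t_def by blast
    define m m' where "m = int N - int N'" and "m' = int M - int M'"
    have diff: "(T ^^ n) x - (T ^^ n) y = x - y + of_int m * t - of_int m' * L"
      by (simp add: N(2) N'(2) m_def m'_def algebra_simps)
    define P where "P = real n powr \<epsilon>"
    have P1: "P \<ge> 1" using n pos by (simp add: P_def ge_one_powr_ge_zero)
    have m: "\<bar>of_int m\<bar> \<le> K' * P"
    proof -
      have "real_of_int m = (real N - L * real n) - (real N' - L * real n)" by (simp add: m_def)
      then have "\<bar>real_of_int m\<bar> \<le> \<bar>real N - L * real n\<bar> + \<bar>real N' - L * real n\<bar>"
        by (simp only: abs_triangle_ineq4)
      also have "\<dots> \<le> K' / 2 * P + K' / 2 * P"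
        unfolding P_def by (intro add_mono dens[OF N(1,5)] dens[OF N'(1,5)])
      finally show ?thesis by simp
    qed
    have mt: "\<bar>of_int m * t\<bar> \<le> \<bar>of_int m\<bar>" using t by (simp add: abs_mult mult_left_le)
    have "\<bar>of_int m'\<bar> \<le> \<bar>of_int m' * L\<bar>"
    proof -
      have "\<bar>real_of_int m'\<bar> * 1 \<le> \<bar>real_of_int m'\<bar> * L" using L by (intro mult_left_mono) auto
      then show ?thesis using L by (simp add: abs_mult)
    qed
    also have "\<dots> \<le> 2 + \<bar>of_int m\<bar>" using diff mt xy N(3,4) N'(3,4) by linarith
    finally have m': "\<bar>real_of_int m'\<bar> \<le> 2 + \<bar>of_int m\<bar>" .
    \<comment> \<open>The 5 is 2 * 2 + 1, from |m'| \<le> 2 + |m|; it is absorbed using P \<ge>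
      1.\<close>
    have R: "2 * \<bar>real_of_int m\<bar> + 1 \<le> (2 * K' + 5) * P" "2 * \<bar>real_of_int m'\<bar> + 1 \<le> (2 * K' + 5) * P"
      using m m' P1 by (simp_all add: algebra_simps)
    have "c * real n powr (-4 * \<epsilon>) = 1 / ((real k + 1) * (((2 * K' + 5) * P)\<^sup>2 * ((2 * K' + 5) * P)\<^sup>2))"
    proof -
      have "real n powr (4 * \<epsilon>) = P ^ 4"
        using n by (simp add: P_def powr_powr flip: powr_realpow) (simp add: mult.commute)
      then have "real n powr (-4 * \<epsilon>) = 1 / P ^ 4" by (simp add: powr_minus_divide)
      then show ?thesis by (simp add: c_def power_mult_distrib power2_eq_square power4_eq_xxxx mult_ac)
    qed
    also have "\<dots> \<le> 1 / ((real k + 1) * ((2 * \<bar>of_int m\<bar> + 1)\<^sup>2 * (2 * \<bar>of_int m'\<bar> + 1)\<^sup>2))"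
    proof (intro divide_left_mono mult_left_mono mult_mono power_mono R)
      have "0 < (2 * K' + 5) * P" using K'0 P1 by (intro mult_pos_pos) auto
      then show "0 < (real k + 1) * (((2 * K' + 5) * P)\<^sup>2 * ((2 * K' + 5) * P)\<^sup>2) *
        ((real k + 1) * ((2 * \<bar>real_of_int m\<bar> + 1)\<^sup>2 * (2 * \<bar>real_of_int m'\<bar> + 1)\<^sup>2))"
        by (intro mult_pos_pos[of "_ * _" "_ * _"] mult_pos_pos[of "real k + 1"] mult_pos_pos[of "_\<^sup>2"] zero_less_power) auto
    qed auto
    also have "\<dots> \<le> \<bar>(T ^^ n) x - (T ^^ n) y\<bar>" unfolding diff by (rule lat)
    finally show ?thesis .
  qed
  with c show ?thesis by blast
qed

section \<open>From polynomial separation to the limit inferior\<close>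

lemma liminf_powr_PInfty:
  fixes f :: "nat \<Rightarrow> real"
  assumes c: "c > 0" and lower: "\<And>n. n \<ge> 1 \<Longrightarrow> c * real n powr -\<beta> \<le> f n" and \<beta>: "\<beta> < \<alpha>"
  shows "liminf (\<lambda>n. ereal (real n powr \<alpha> * f n)) = \<infinity>"
proof -
  have "filterlim (\<lambda>n. c * real n powr (\<alpha> - \<beta>)) at_top sequentially"
    using c \<beta> by real_asymp
  moreover have "\<forall>\<^sub>F n in sequentially. c * real n powr (\<alpha> - \<beta>) \<le> real n powr \<alpha> * f n"
    using eventually_ge_at_top[of 1]
  proof eventually_elim
    case (elim n)
    have "c * real n powr (\<alpha> - \<beta>) = real n powr \<alpha> * (c * real n powr -\<beta>)"
      by (simp add: powr_diff powr_minus_divide)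
    also have "\<dots> \<le> real n powr \<alpha> * f n" using lower[OF elim] by (intro mult_left_mono) auto
    finally show ?case .
  qed
  ultimately have "filterlim (\<lambda>n. real n powr \<alpha> * f n) at_top sequentially"
    by (rule filterlim_at_top_mono)
  then have "(\<lambda>n. ereal (real n powr \<alpha> * f n)) \<longlonglongrightarrow> \<infinity>" by (simp add: tendsto_PInfty_eq_at_top)
  then show ?thesis by (intro lim_imp_Liminf) auto
qed

text \<open>The simplex is parametrised by its first two lengths, which carries its Lebesgue measure
  to a constant multiple of the planar one on the triangle.\<close>

theorem theorem4p16:
  shows "AE p in (lborel :: (real \<times> real) measure).
     (0 < fst p \<and> 0 < snd p \<and> fst p + snd p < 1) \<longrightarrow>
     (\<forall>\<alpha>::real. \<alpha> > 0 \<longrightarrow>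
        (AE q in (lborel :: (real \<times> real) measure).
           q \<in> {0..<1} \<times> {0..<1} \<longrightarrow>
           liminf (\<lambda>n::nat. ereal (real n powr \<alpha> *
              \<bar>((iet 3 (\<lambda>k. 4 - k) (len3 (fst p) (snd p))) ^^ n) (fst q)
               - ((iet 3 (\<lambda>k. 4 - k) (len3 (fst p) (snd p))) ^^ n) (snd q)\<bar>)) = \<infinity>))"
  using AE_rotation_diophantine
proof (eventually_elim, intro impI allI)
  fix p :: "real \<times> real" and \<alpha> :: real
  assume far: "\<forall>e::nat. \<exists>k::nat. \<forall>i j.
     1 / ((real k + 1) * ((real i + 1) powr (1 + 1 / (real e + 1)) * (real j + 1) powr (1 + 1 / (real e + 1))))
       \<le> \<bar>fst p - (1 - real j * (1 + snd p) / (real i + 1))\<bar>"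
    and "0 < fst p \<and> 0 < snd p \<and> fst p + snd p < 1" and \<alpha>: "\<alpha> > 0"
  then have ab: "fst p > 0" "snd p > 0" "fst p + snd p < 1" by auto
  \<comment> \<open>The exponent 1 + 1 / (e + 1) leads to \<epsilon> = 2 / (e + 1), and 4 \<epsilon>
    must stay below \<alpha>. This choice depends on \<alpha>, but the null set of length vectors
    does not.\<close>
  obtain e :: nat where "8 / \<alpha> < real e" using reals_Archimedean2 by blast
  then have e: "8 / (real e + 1) < \<alpha>" using \<alpha> by (simp add: field_simps)
  obtain k where k: "\<And>i j.
     1 / ((real k + 1) * ((real i + 1) powr (1 + 1 / (real e + 1)) * (real j + 1) powr (1 + 1 / (real e + 1))))
       \<le> \<bar>fst p - (1 - real j * (1 + snd p) / (real i + 1))\<bar>"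
    using far by blast
  define \<epsilon> where "\<epsilon> = 2 * (1 / (real e + 1))"
  define \<delta> where "\<delta> = 1 / ((real k + 1) * 2 powr (2 + 1 / (real e + 1)))"
  have pos: "\<delta> > 0" "\<epsilon> > 0" by (simp_all add: \<delta>_def \<epsilon>_def)
  have dio: "\<delta> * real q powr (-1-\<epsilon>) \<le> \<bar>real q * ((1 - fst p) / (1 + snd p)) - of_int r\<bar>"
    if "q \<ge> 1" for q :: nat and r :: int
    unfolding \<delta>_def \<epsilon>_def by (rule rotation_diophantine[OF ab _ that k]) simp
  show "AE q in (lborel :: (real \<times> real) measure). q \<in> {0..<1} \<times> {0..<1} \<longrightarrow>
           liminf (\<lambda>n::nat. ereal (real n powr \<alpha> *
              \<bar>((iet 3 (\<lambda>k. 4 - k) (len3 (fst p) (snd p))) ^^ n) (fst q)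
               - ((iet 3 (\<lambda>k. 4 - k) (len3 (fst p) (snd p))) ^^ n) (snd q)\<bar>)) = \<infinity>"
    using AE_difference_far_from_lattice[of "1 - fst p" "1 + snd p"]
  proof (eventually_elim, intro impI)
    fix q :: "real \<times> real"
    assume lat: "\<exists>k::nat. \<forall>m m' :: int.
       1 / ((real k + 1) * ((2 * \<bar>of_int m\<bar> + 1)\<^sup>2 * (2 * \<bar>of_int m'\<bar> + 1)\<^sup>2))
         \<le> \<bar>fst q - snd q + of_int m * (1 - fst p) - of_int m' * (1 + snd p)\<bar>"
      and "q \<in> {0..<1} \<times> {0..<1}"
    then have xy: "0 \<le> fst q" "fst q < 1" "0 \<le> snd q" "snd q < 1" by (auto simp: mem_Times_iff)
    obtain l :: nat where l: "\<And>m m' :: int.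
       1 / ((real l + 1) * ((2 * \<bar>of_int m\<bar> + 1)\<^sup>2 * (2 * \<bar>of_int m'\<bar> + 1)\<^sup>2))
         \<le> \<bar>fst q - snd q + of_int m * (1 - fst p) - of_int m' * (1 + snd p)\<bar>"
      using lat by blast
    obtain c where c: "c > 0" "\<And>n::nat. n \<ge> 1 \<Longrightarrow> c * real n powr (-4 * \<epsilon>) \<le>
        \<bar>((iet 3 (\<lambda>k. 4 - k) (len3 (fst p) (snd p))) ^^ n) (fst q)
               - ((iet 3 (\<lambda>k. 4 - k) (len3 (fst p) (snd p))) ^^ n) (snd q)\<bar>"
      using iet_321_separation[OF ab pos dio l xy] by blast
    show "liminf (\<lambda>n::nat. ereal (real n powr \<alpha> *
              \<bar>((iet 3 (\<lambda>k. 4 - k) (len3 (fst p) (snd p))) ^^ n) (fst q)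
               - ((iet 3 (\<lambda>k. 4 - k) (len3 (fst p) (snd p))) ^^ n) (snd q)\<bar>)) = \<infinity>"
      using c e by (intro liminf_powr_PInfty[of c "4 * \<epsilon>"]) (auto simp: \<epsilon>_def)
  qed
qed

end
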